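(* Let $p\ge 1$, $\alpha>0$, $\beta\in(0,1]$, and let $f,g$ be two positive functions on $[1,\infty)$ such that for all $x>1$, $\mathcal{H}^{\alpha,\beta}_{1,x}[f^{p}(x)]<\infty$ and $\mathcal{H}^{\alpha,\beta}_{1,x}[g^{p}(x)]<\infty$. Let $x>1$ and let $m,M$ be real constants such that $0<m\le \frac{f(\tau)}{g(\tau)}\le M$ for all $\tau\in(1,x)$. Then $$\left[\mathcal{H}^{\alpha,\beta}_{1,x}[f^{p}(x)]\right]^{\frac1p}+\left[\mathcal{H}^{\alpha,\beta}_{1,x}[g^{p}(x)]\right]^{\frac1p}\le \frac{1+M(m+2)}{(m+1)(M+1)}\left[\mathcal{H}^{\alpha,\beta}_{1,x}[(f+g)^{p}(x)]\right]^{\frac1p}.$$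
   Context: For $\alpha>0$, $\beta\in(0,1]$ and $x>1$, the one-sided generalized proportional Hadamard fractional integral of a (measurable) function $z$ on $[1,\infty)$ is $$\mathcal{H}^{\alpha,\beta}_{1,x}[z(x)]=(\mathcal{H}^{\alpha,\beta}_{1,x}z)(x)=\frac{1}{\beta^{\alpha}\Gamma(\alpha)}\int_{1}^{x}e^{\frac{\beta-1}{\beta}(\ln x-\ln t)}(\ln x-\ln t)^{\alpha-1}\frac{z(t)}{t}\,dt,$$ where $\Gamma$ is the gamma function. Functions are real-valued and measurable, $f^p(x)$ means $(f(x))^p$, and $(f+g)^p(x)$ means $(f(x)+g(x))^p$. *)

theory Defs
  imports "HOL-Analysis.Analysis"
begin

definition hadamard_integrand :: "real \<Rightarrow> real \<Rightarrow> real \<Rightarrow> (real \<Rightarrow> real) \<Rightarrow> real \<Rightarrow> real" where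
  "hadamard_integrand \<alpha> \<beta> x z t =
     exp ((\<beta> - 1) / \<beta> * (ln x - ln t)) * (ln x - ln t) powr (\<alpha> - 1) * (z t / t)"

text \<open>
  The Lebesgue integral is meaningful only for integrable integrands (otherwise it is \<open>0\<close> by
  convention), so its finiteness is the separate predicate \<open>hadamard_finite\<close>. For a measurable
  nonnegative \<open>z\<close> this is precisely finiteness of the integral with values in \<open>[0, \<infinity>]\<close>.
\<close>

definition hadamard_integral :: "real \<Rightarrow> real \<Rightarrow> real \<Rightarrow> (real \<Rightarrow> real) \<Rightarrow> real" where
  "hadamard_integral \<alpha> \<beta> x z =
     1 / (\<beta> powr \<alpha> * Gamma \<alpha>) * (LINT t:{1..x}|lebesgue. hadamard_integrand \<alpha> \<beta> x z t)"

definition hadamard_finite :: "real \<Rightarrow> real \<Rightarrow> real \<Rightarrow> (real \<Rightarrow> real) \<Rightarrow> bool" where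
  "hadamard_finite \<alpha> \<beta> x z \<longleftrightarrow> set_integrable lebesgue {1..x} (hadamard_integrand \<alpha> \<beta> x z)"

end

theory Submission
  imports Defs
begin

text \<open>
  The two sides of the ratio bound say that, on the open interval, each of \<open>f\<close> and \<open>g\<close> is at most a
  fixed proportion of the sum: \<open>f / g \<le> M\<close> gives \<open>f \<le> M / (M + 1) * (f + g)\<close>, and \<open>m \<le> f / g\<close> gives
  \<open>g \<le> 1 / (m + 1) * (f + g)\<close>.  For a nonnegative kernel, \<open>u \<mapsto> H(u\<^sup>p)\<^bsup>1/p\<^esup>\<close> is monotone and
  positively homogeneous (\<open>hadamard_norm_mono\<close>), so the two pointwise bounds pass to the integrals,
  and the constant of the theorem is the sum
  \<open>M / (M + 1) + 1 / (m + 1)\<close>.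

  The one analytic point is that \<open>(f + g)\<^sup>p\<close> must be integrable against the kernel, since a divergent
  integral would be read as \<open>0\<close>.  This again comes from the ratio bound: \<open>f + g \<le> (M + 1) * g\<close>
  on the open interval, so the finiteness for \<open>g\<^sup>p\<close> dominates (\<open>hadamard_finite_dominated\<close>).
\<close>

lemma hadamard_integrand_mono:
  assumes "t > 0" and "z t \<le> w t"
  shows "hadamard_integrand \<alpha> \<beta> x z t \<le> hadamard_integrand \<alpha> \<beta> x w t"
  unfolding hadamard_integrand_def
  using assms by (intro mult_left_mono divide_right_mono mult_nonneg_nonneg) auto

lemma hadamard_integrand_nonneg:
  assumes "t > 0" and "z t \<ge> 0"
  shows "hadamard_integrand \<alpha> \<beta> x z t \<ge> 0"
  unfolding hadamard_integrand_def using assms by simp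

lemma hadamard_integrand_cmult:
  "hadamard_integrand \<alpha> \<beta> x (\<lambda>t. c * z t) t = c * hadamard_integrand \<alpha> \<beta> x z t"
  unfolding hadamard_integrand_def by simp

lemma hadamard_finite_cmult:
  assumes "hadamard_finite \<alpha> \<beta> x z"
  shows "hadamard_finite \<alpha> \<beta> x (\<lambda>t. c * z t)"
  using assms unfolding hadamard_finite_def hadamard_integrand_cmult by simp

lemma hadamard_integral_cmult:
  "hadamard_integral \<alpha> \<beta> x (\<lambda>t. c * z t) = c * hadamard_integral \<alpha> \<beta> x z"
  unfolding hadamard_integral_def hadamard_integrand_cmult by simp

lemma hadamard_integral_nonneg:
  assumes "\<alpha> > 0" and "\<And>t. t \<in> {1..x} \<Longrightarrow> z t \<ge> 0"
  shows "hadamard_integral \<alpha> \<beta> x z \<ge> 0"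
proof -
  have "(LINT t:{1..x}|lebesgue. hadamard_integrand \<alpha> \<beta> x z t) \<ge> 0"
    unfolding set_lebesgue_integral_def
    by (intro Bochner_Integration.integral_nonneg)
      (auto simp: indicator_def intro!: hadamard_integrand_nonneg assms(2))
  then show ?thesis
    unfolding hadamard_integral_def using Gamma_real_pos[OF assms(1)] by simp
qed

lemma AE_lebesgue_neq: "AE t in lebesgue. t \<noteq> (a::real)"
  using AE_lborel_singleton[of a] by (rule AE_completion)

text \<open>
  The comparisons below ask for their pointwise bounds on the open interval only; its endpoints
  form a null set.
\<close>

lemma hadamard_integral_mono:
  assumes "\<alpha> > 0"
    and "hadamard_finite \<alpha> \<beta> x z" and "hadamard_finite \<alpha> \<beta> x w"
    and le: "\<And>t. t \<in> {1<..<x} \<Longrightarrow> z t \<le> w t"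
  shows "hadamard_integral \<alpha> \<beta> x z \<le> hadamard_integral \<alpha> \<beta> x w"
proof -
  have "AE t in lebesgue. t \<in> {1..x} \<longrightarrow>
      hadamard_integrand \<alpha> \<beta> x z t \<le> hadamard_integrand \<alpha> \<beta> x w t"
    using AE_lebesgue_neq[of 1] AE_lebesgue_neq[of x]
    by eventually_elim (auto intro!: hadamard_integrand_mono le)
  then have "(LINT t:{1..x}|lebesgue. hadamard_integrand \<alpha> \<beta> x z t)
      \<le> (LINT t:{1..x}|lebesgue. hadamard_integrand \<alpha> \<beta> x w t)"
    using assms(2,3) unfolding hadamard_finite_def
    by (intro set_integral_mono_AE) auto
  then show ?thesis
    unfolding hadamard_integral_def using Gamma_real_pos[OF assms(1)]
    by (intro mult_left_mono) auto
qed

lemma hadamard_finite_dominated: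
  assumes z: "z \<in> borel_measurable (lebesgue_on {1..})"
    and w: "hadamard_finite \<alpha> \<beta> x w"
    and bound: "\<And>t. t \<in> {1<..<x} \<Longrightarrow> 0 \<le> z t \<and> z t \<le> w t"
  shows "hadamard_finite \<alpha> \<beta> x z"
proof -
  have "(\<lambda>t. exp ((\<beta> - 1) / \<beta> * (ln x - ln t)) * (ln x - ln t) powr (\<alpha> - 1))
      \<in> borel_measurable (lebesgue_on {1..x})"
    by (intro measurable_restrict_space1 measurable_completion) measurable
  moreover have "z \<in> borel_measurable (lebesgue_on {1..x})"
    by (rule measurable_restrict_mono[OF z]) auto
  moreover have "(\<lambda>t. t) \<in> borel_measurable (lebesgue_on {1..x})"
    by (intro measurable_restrict_space1 measurable_completion) measurable
  ultimately have "hadamard_integrand \<alpha> \<beta> x z \<in> borel_measurable (lebesgue_on {1..x})"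
    unfolding hadamard_integrand_def[abs_def]
    by (rule borel_measurable_times[OF _ borel_measurable_divide])
  then have meas: "set_borel_measurable lebesgue {1..x} (hadamard_integrand \<alpha> \<beta> x z)"
    unfolding set_borel_measurable_def by (simp add: borel_measurable_restrict_space_iff)
  have "AE t in lebesgue. t \<in> {1..x} \<longrightarrow>
      norm (hadamard_integrand \<alpha> \<beta> x z t) \<le> norm (hadamard_integrand \<alpha> \<beta> x w t)"
    using AE_lebesgue_neq[of 1] AE_lebesgue_neq[of x]
  proof eventually_elim
    case (elim t)
    show ?case
    proof
      assume "t \<in> {1..x}"
      with elim bound[of t] have "t > 0" "0 \<le> z t" "z t \<le> w t" by auto
      then show "norm (hadamard_integrand \<alpha> \<beta> x z t) \<le> norm (hadamard_integrand \<alpha> \<beta> x w t)"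
        using hadamard_integrand_nonneg[of t z \<alpha> \<beta> x] hadamard_integrand_mono[of t z w \<alpha> \<beta> x]
        by simp
    qed
  qed
  then show ?thesis
    using w meas unfolding hadamard_finite_def by (rule set_integrable_bound[rotated 2])
qed

text \<open>
  The \<open>p\<close>-th root undoes the factor \<open>c\<^sup>p\<close> that comes out of the integral, so the bound passes from
  the integrands to the weighted \<open>p\<close>-norms with the same constant \<open>c\<close>.
\<close>

lemma hadamard_norm_mono:
  assumes "\<alpha> > 0" and "p > 0" and "c \<ge> 0"
    and "hadamard_finite \<alpha> \<beta> x (\<lambda>t. u t powr p)"
    and "hadamard_finite \<alpha> \<beta> x (\<lambda>t. v t powr p)"
    and bound: "\<And>t. t \<in> {1<..<x} \<Longrightarrow> 0 \<le> u t \<and> 0 \<le> v t \<and> u t \<le> c * v t"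
  shows "hadamard_integral \<alpha> \<beta> x (\<lambda>t. u t powr p) powr (1 / p)
    \<le> c * hadamard_integral \<alpha> \<beta> x (\<lambda>t. v t powr p) powr (1 / p)"
proof -
  let ?U = "hadamard_integral \<alpha> \<beta> x (\<lambda>t. u t powr p)"
  let ?V = "hadamard_integral \<alpha> \<beta> x (\<lambda>t. v t powr p)"
  have "u t powr p \<le> c powr p * v t powr p" if "t \<in> {1<..<x}" for t
    using powr_mono2[of p "u t" "c * v t"] bound[OF that] assms(2,3) by (simp add: powr_mult)
  then have "?U \<le> hadamard_integral \<alpha> \<beta> x (\<lambda>t. c powr p * v t powr p)"
    using assms(1,4,5) by (intro hadamard_integral_mono hadamard_finite_cmult)
  then have "?U \<le> c powr p * ?V"
    by (simp only: hadamard_integral_cmult)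
  moreover have "?U \<ge> 0" "?V \<ge> 0"
    using assms(1) by (auto intro: hadamard_integral_nonneg)
  ultimately have "?U powr (1 / p) \<le> (c powr p * ?V) powr (1 / p)"
    using assms(2) by (intro powr_mono2) auto
  also have "\<dots> = c * ?V powr (1 / p)"
    using assms(2,3) \<open>?V \<ge> 0\<close> by (simp add: powr_mult powr_powr)
  finally show ?thesis .
qed

theorem theorem3p1:
  fixes p \<alpha> \<beta> x m M :: real and f g :: "real \<Rightarrow> real"
  assumes "p \<ge> 1" and "\<alpha> > 0" and "0 < \<beta>" and "\<beta> \<le> 1"
    and "f \<in> borel_measurable (lebesgue_on {1..})"
    and "g \<in> borel_measurable (lebesgue_on {1..})"
    and "\<And>t. t \<ge> 1 \<Longrightarrow> f t > 0"
    and "\<And>t. t \<ge> 1 \<Longrightarrow> g t > 0"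
    and "\<And>y. y > 1 \<Longrightarrow> hadamard_finite \<alpha> \<beta> y (\<lambda>t. f t powr p)"
    and "\<And>y. y > 1 \<Longrightarrow> hadamard_finite \<alpha> \<beta> y (\<lambda>t. g t powr p)"
    and "x > 1"
    and "0 < m"
    and "\<And>\<tau>. \<tau> \<in> {1<..<x} \<Longrightarrow> m \<le> f \<tau> / g \<tau> \<and> f \<tau> / g \<tau> \<le> M"
  shows "hadamard_integral \<alpha> \<beta> x (\<lambda>t. f t powr p) powr (1 / p)
       + hadamard_integral \<alpha> \<beta> x (\<lambda>t. g t powr p) powr (1 / p)
       \<le> (1 + M * (m + 2)) / ((m + 1) * (M + 1))
         * hadamard_integral \<alpha> \<beta> x (\<lambda>t. (f t + g t) powr p) powr (1 / p)"
proof -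
  have pos: "f t > 0" "g t > 0" if "t \<in> {1<..<x}" for t
    using that assms(7,8)[of t] by auto
  \<comment> \<open>Positivity of \<open>M\<close> needs a point at which the ratio bound holds; the midpoint serves.\<close>
  have "m \<le> M"
    using assms(11) assms(13)[of "(1 + x) / 2"] by (auto simp: field_simps)
  then have M: "M > 0"
    using assms(12) by simp
  have ratio: "m * g t \<le> f t" "f t \<le> M * g t" if "t \<in> {1<..<x}" for t
    using assms(13)[OF that] pos[OF that] by (auto simp: field_simps)

  have "hadamard_finite \<alpha> \<beta> x (\<lambda>t. (f t + g t) powr p)"
  proof (rule hadamard_finite_dominated)
    show "(\<lambda>t. (f t + g t) powr p) \<in> borel_measurable (lebesgue_on {1..})"
      using assms(5,6) by measurable
    show "hadamard_finite \<alpha> \<beta> x (\<lambda>t. (M + 1) powr p * g t powr p)"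
      using assms(10)[OF assms(11)] by (rule hadamard_finite_cmult)
    show "0 \<le> (f t + g t) powr p \<and> (f t + g t) powr p \<le> (M + 1) powr p * g t powr p"
      if "t \<in> {1<..<x}" for t
    proof -
      have "(f t + g t) powr p \<le> ((M + 1) * g t) powr p"
        using ratio[OF that] pos[OF that] assms(1)
        by (intro powr_mono2) (auto simp: algebra_simps)
      then show ?thesis
        using pos[OF that] M by (simp add: powr_mult)
    qed
  qed
  note finite = assms(9)[OF assms(11)] assms(10)[OF assms(11)] this

  let ?S = "hadamard_integral \<alpha> \<beta> x (\<lambda>t. (f t + g t) powr p) powr (1 / p)"
  have "hadamard_integral \<alpha> \<beta> x (\<lambda>t. f t powr p) powr (1 / p) \<le> M / (M + 1) * ?S"
  proof (rule hadamard_norm_mono)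
    show "0 \<le> f t \<and> 0 \<le> f t + g t \<and> f t \<le> M / (M + 1) * (f t + g t)"
      if "t \<in> {1<..<x}" for t
      using ratio[OF that] pos[OF that] M by (simp add: field_simps)
  qed (use finite assms M in auto)
  moreover have "hadamard_integral \<alpha> \<beta> x (\<lambda>t. g t powr p) powr (1 / p) \<le> 1 / (m + 1) * ?S"
  proof (rule hadamard_norm_mono)
    show "0 \<le> g t \<and> 0 \<le> f t + g t \<and> g t \<le> 1 / (m + 1) * (f t + g t)"
      if "t \<in> {1<..<x}" for t
      using ratio[OF that] pos[OF that] assms(12) by (simp add: field_simps)
  qed (use finite assms in auto)
  moreover have "(1 + M * (m + 2)) / ((m + 1) * (M + 1)) = M / (M + 1) + 1 / (m + 1)"
    using M assms(12) by (simp add: add_frac_eq algebra_simps)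
  ultimately show ?thesis
    by (simp only: distrib_right)
qed

end
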